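(* Let $n\ge 3$ and $1\le k\le n-1$ be integers with $\gcd(n,k)=1$, let $c$ be a positive real number, and let $p_c(z) = z^n + c\,\overline{z}^{\,k} - 1$ for $z\in\mathbb{C}$. Let $M := \max(1,|c|)$, and let $r \neq 1$ be a positive real root of the equation $x^{n+1} -(1+M)x^n+M=0$. Then all the zeros of $p_c$ in $\mathbb{C}$ lie in the closed disk $\{z\in\mathbb{C}: |z|\le R\}$, where $R = \max(1, r)$.
   Context: The bar denotes complex conjugation. *)

theory Defs
  imports Complex_Main
begin

definition harmonic_trinomial :: "nat \<Rightarrow> nat \<Rightarrow> real \<Rightarrow> complex \<Rightarrow> complex" where
  "harmonic_trinomial n k c z = z ^ n + of_real c * cnj z ^ k - 1"

end

theory Submission
  imports Defs
begin

text \<open>A zero of modulus \<open>t\<close> satisfies \<open>t ^ n \<le> c * t ^ k + 1 \<le> M * (\<Sum>i<n. t ^ i)\<close>. Dividing the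
  equation of \<open>r\<close> by \<open>r - 1\<close> gives \<open>r ^ n = M * (\<Sum>i<n. r ^ i)\<close>. Since \<open>(\<Sum>i<n. x ^ i) / x ^ n\<close> is
  strictly decreasing in \<open>x > 0\<close>, this forces \<open>t \<le> r\<close>.\<close>

text \<open>Holds term by term: cancelling \<open>t ^ i * s ^ i\<close> leaves
  \<open>s ^ (n - i) < t ^ (n - i)\<close>, strict as \<open>i < n\<close>. Cross-multiplied to
  avoid quotients.\<close>

lemma geometric_sum_ratio_strict_antimono:
  fixes s t :: real
  assumes "0 < s" "s < t" "0 < n"
  shows "(\<Sum>i<n. t ^ i) * s ^ n < (\<Sum>i<n. s ^ i) * t ^ n"
proof -
  have "t ^ i * s ^ n < s ^ i * t ^ n" if "i < n" for i
  proof -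
    have "s ^ (n - i) < t ^ (n - i)"
      using assms that by (intro power_strict_mono) auto
    then have "t ^ i * s ^ i * s ^ (n - i) < t ^ i * s ^ i * t ^ (n - i)"
      using assms by simp
    moreover have "s ^ n = s ^ i * s ^ (n - i)" "t ^ n = t ^ i * t ^ (n - i)"
      using that by (simp_all flip: power_add)
    ultimately show ?thesis
      by (simp add: mult_ac)
  qed
  then show ?thesis
    unfolding sum_distrib_right using assms by (intro sum_strict_mono) auto
qed

lemma harmonic_trinomial_zero_norm_le:
  fixes c M :: real
  assumes "0 < k" "k < n" "\<bar>c\<bar> \<le> M" "1 \<le> M" "harmonic_trinomial n k c z = 0"
  shows "cmod z ^ n \<le> M * (\<Sum>i<n. cmod z ^ i)"
proof -
  have "z ^ n = 1 - of_real c * cnj z ^ k"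
    using assms by (simp add: harmonic_trinomial_def algebra_simps)
  then have "cmod z ^ n = cmod (1 - of_real c * cnj z ^ k)"
    by (simp flip: norm_power)
  also have "\<dots> \<le> 1 + \<bar>c\<bar> * cmod z ^ k"
    using norm_triangle_ineq4[of 1 "of_real c * cnj z ^ k"]
    by (simp add: norm_mult norm_power)
  \<comment> \<open>Both coefficients are at most \<open>M\<close>, and \<open>0 < k < n\<close>
    makes \<open>0\<close> and \<open>k\<close> distinct indices of the full sum.\<close>
  also have "\<dots> \<le> M * (\<Sum>i\<in>{0, k}. cmod z ^ i)"
    using assms by (simp add: distrib_left add_mono mult_right_mono)
  also have "\<dots> \<le> M * (\<Sum>i<n. cmod z ^ i)"
    using assms by (intro mult_left_mono sum_mono2) auto
  finally show ?thesis .
qed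

theorem corollary3p2:
  fixes n k :: nat and c M r R :: real
  assumes "n \<ge> 3" and "1 \<le> k" and "k \<le> n - 1" and "gcd n k = 1"
    and "c > 0"
    and "M = max 1 \<bar>c\<bar>"
    and "r > 0" and "r \<noteq> 1" and "r ^ (n + 1) - (1 + M) * r ^ n + M = 0"
    and "R = max 1 r"
  shows "{z. harmonic_trinomial n k c z = 0} \<subseteq> {z. cmod z \<le> R}"
proof -
  \<comment> \<open>The right side regroups the polynomial in the equation of \<open>r\<close>,
    exposing its trivial root 1.\<close>
  have "(r - 1) * (r ^ n - M * (\<Sum>i<n. r ^ i)) = (r - 1) * r ^ n - M * (r ^ n - 1)"
    by (simp add: power_diff_1_eq algebra_simps)
  also have "\<dots> = 0"
    using assms(9) by (simp add: algebra_simps)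
  finally have r: "r ^ n = M * (\<Sum>i<n. r ^ i)"
    using \<open>r \<noteq> 1\<close> by simp
  have "cmod z \<le> r" if "harmonic_trinomial n k c z = 0" for z
  proof (rule ccontr)
    let ?t = "cmod z"
    assume "\<not> ?t \<le> r"
    then have "(\<Sum>i<n. ?t ^ i) * r ^ n < (\<Sum>i<n. r ^ i) * ?t ^ n"
      using assms by (intro geometric_sum_ratio_strict_antimono) auto
    then have "M * ((\<Sum>i<n. ?t ^ i) * r ^ n) < M * ((\<Sum>i<n. r ^ i) * ?t ^ n)"
      using assms(6) by (intro mult_strict_left_mono) auto
    \<comment> \<open>The fact \<open>r\<close> absorbs \<open>M\<close> and the sum into
      \<open>r ^ n\<close>; the bound for zeros then returns to the left end of the strict
      inequality.\<close>
    also have "\<dots> = ?t ^ n * r ^ n"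
      by (subst r) simp
    also have "\<dots> \<le> M * (\<Sum>i<n. ?t ^ i) * r ^ n"
      using assms that by (intro mult_right_mono harmonic_trinomial_zero_norm_le) auto
    finally show False
      by simp
  qed
  then show ?thesis
    using assms(10) by fastforce
qed

end
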